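(* Fix a real number $T>0$, and let $\mu=f\pi_T$ be an ultra-log-concave probability measure over $\mathbb N$. Let $M:=\frac{f(1)}{f(0)}$ and let $X_T$ be the Poisson transport map from $\mathbb P$ to $\mu$. Then, $\mathbb P$-almost surely, $$\mathrm D_{(t,z)}X_T\in\{0,1\}\qquad\text{for all }(t,z)\in[0,T]\times[0,M].$$
   Context: $\mathbb N=\{0,1,2,\dots\}$. For $\lambda>0$, $\pi_\lambda(k)=e^{-\lambda}\lambda^k/k!$ is the Poisson measure on $\mathbb N$ with intensity $\lambda$; $\pi_0=\delta_0$. A function $f:\mathbb N\to(0,\infty)$ is log-concave if $f(k)^2\ge f(k-1)f(k+1)$ for all integers $k\ge1$. A probability measure $\mu$ on $\mathbb N$ is ultra-log-concave if $\mu=f\pi_\lambda$ (i.e. $\mu(k)=f(k)\pi_\lambda(k)$ for all $k$) for some $\lambda>0$ and some positive log-concave $f$; this is equivalent to the same property holding for every $\lambda>0$. Thus, given $T>0$, write $\mu=f\pi_T$ with $f:\mathbb N\to(0,\infty)$ log-concave. Poisson semigroup: $\mathrm P_0g=g$ and $\mathrm P_tg(k)=\sum_{n=0}^\infty g(k+n)\pi_t(n)$ for $t>0$, $k\in\mathbb N$. Poisson space: Let $M=f(1)/f(0)$ and $\mathbb X=[0,T]\times[0,M]$ with its Borel $\sigma$-algebra $\mathcal X$ and Lebesgue measure $\mathrm{Leb}$. $\Omega$ is the set of at most countable sums $\omega=\sum_i\delta_{(t_i,z_i)}$ with $(t_i,z_i)\in\mathbb X$; $\mathcal F$ is the $\sigma$-algebra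 generated by the maps $\omega\mapsto\omega(B)$, $B\in\mathcal X$; $\mathbb P$ is the law of the Poisson point process with intensity $\mathrm{Leb}$: $\omega(B)\sim\pi_{\mathrm{Leb}(B)}$ for $B\in\mathcal X$, and $\omega(B_1),\dots,\omega(B_n)$ are independent for disjoint $B_1,\dots,B_n\in\mathcal X$. Malliavin derivative: for measurable $G:\Omega\to\mathbb R$, $\mathrm D_{(t,z)}G(\omega):=G(\omega+\delta_{(t,z)})-G(\omega)$ for $(t,z)\in\mathbb X$, $\omega\in\Omega$. Poisson transport map: the processes $(X_t)_{t\in[0,T]}$ and $(\lambda_t)_{t\in[0,T]}$ on $\Omega$ are the solution of the system $$X_t(\omega)=\omega\big(\{(s,x)\in\mathbb X:\ s<t,\ x\le\lambda_s(\omega)\}\big),\qquad \lambda_t(\omega)=\frac{\mathrm P_{T-t}f(X_t(\omega)+1)}{\mathrm P_{T-t}f(X_t(\omega))},\qquad t\in[0,T].$$ (For every $\omega$ with finitely many atoms, hence $\mathbb P$-a.s., this system determines both processes recursively along the atom times, starting from $X_0=0$; one has $0\le\lambda_t\le M$.) The random variable $X_T:\Omega\to\mathbb N$ is called the Poisson transport map; its law under $\mathbb P$ is $\mu$. *)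

theory Defs
  imports "HOL-Probability.Probability"
begin

section \<open>Ultra-log-concave measures and the Poisson semigroup\<close>

text \<open>\<^const>\<open>poisson_pmf\<close> is only specified for positive rates; intensity 0 gives the Dirac mass
  at 0.\<close>

definition poisson_law :: "real \<Rightarrow> nat pmf" where
  "poisson_law l = (if l = 0 then return_pmf 0 else poisson_pmf l)"

definition log_concave :: "(nat \<Rightarrow> real) \<Rightarrow> bool" where
  "log_concave f \<longleftrightarrow> (\<forall>k\<ge>1. (f k)\<^sup>2 \<ge> f (k - 1) * f (k + 1))"

definition ultra_log_concave :: "nat pmf \<Rightarrow> bool" where
  "ultra_log_concave \<mu> \<longleftrightarrow>
     (\<exists>l f. l > 0 \<and> (\<forall>k. f k > 0) \<and> log_concave f \<and>
        (\<forall>k. pmf \<mu> k = f k * pmf (poisson_law l) k))"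

definition poisson_semigroup :: "real \<Rightarrow> (nat \<Rightarrow> real) \<Rightarrow> nat \<Rightarrow> real" where
  "poisson_semigroup t g k =
     (if t = 0 then g k else (\<Sum>n. g (k + n) * pmf (poisson_law t) n))"


section \<open>Poisson space\<close>

text \<open>At most countable sums of Dirac masses at points of \<open>N\<close>: the push-forward along \<open>p\<close> of the
  counting measure on an index set \<open>I\<close> is the sum over \<open>i \<in> I\<close> of the Dirac masses at \<open>p i\<close>
  (multiplicities are allowed).\<close>

definition configurations :: "'a measure \<Rightarrow> 'a measure set" where
  "configurations N = {distr (count_space I) N p | (I :: nat set) p. p \<in> I \<rightarrow> space N}"

text \<open>The \<open>\<sigma>\<close>-algebra generated by the evaluations, in the style of \<^const>\<open>subprob_algebra\<close>.\<close>

definition configuration_algebra :: "'a measure \<Rightarrow> 'a measure measure" where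
  "configuration_algebra N =
     (SUP B\<in>sets N. vimage_algebra (configurations N) (\<lambda>\<omega>. emeasure \<omega> B) borel)"

text \<open>\<open>P\<close> is the law of the Poisson point process whose intensity is the finite measure \<open>N\<close>.\<close>

definition poisson_process_law :: "'a measure \<Rightarrow> 'a measure measure \<Rightarrow> bool" where
  "poisson_process_law N P \<longleftrightarrow>
     prob_space P \<and> space P = configurations N \<and> sets P = sets (configuration_algebra N) \<and>
     (\<forall>B\<in>sets N. distr P borel (\<lambda>\<omega>. emeasure \<omega> B) =
                  distr (measure_pmf (poisson_law (measure N B))) borel (of_nat :: nat \<Rightarrow> ennreal)) \<and>
     (\<forall>(n::nat) B. (\<forall>i<n. B i \<in> sets N) \<longrightarrow> disjoint_family_on B {..<n} \<longrightarrow>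
        prob_space.indep_vars P (\<lambda>_. borel) (\<lambda>i \<omega>. emeasure \<omega> (B i)) {..<n})"

definition add_dirac :: "'a measure \<Rightarrow> 'a \<Rightarrow> 'a measure" where
  "add_dirac \<omega> x =
     measure_of (space \<omega>) (sets \<omega>) (\<lambda>B. emeasure \<omega> B + emeasure (return \<omega> x) B)"

lemma sets_add_dirac [simp]: "sets (add_dirac \<omega> x) = sets \<omega>"
  by (simp add: add_dirac_def)

lemma emeasure_add_dirac:
  assumes "B \<in> sets \<omega>"
  shows "emeasure (add_dirac \<omega> x) B = emeasure \<omega> B + indicator B x"
proof -
  let ?m = "\<lambda>B. emeasure \<omega> B + emeasure (return \<omega> x) B"
  have "countably_additive (sets \<omega>) ?m"
    unfolding countably_additive_def
    by (auto simp: suminf_add[symmetric] suminf_emeasure simp del: emeasure_return)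
  moreover have "positive (sets \<omega>) ?m"
    by (simp add: positive_def)
  ultimately have "emeasure (add_dirac \<omega> x) B = ?m B"
    using assms by (intro emeasure_measure_of[OF add_dirac_def])
      (auto dest: sets.sets_into_space simp del: emeasure_return)
  then show ?thesis
    using assms by simp
qed

definition malliavin :: "('a measure \<Rightarrow> real) \<Rightarrow> 'a \<Rightarrow> 'a measure \<Rightarrow> real" where
  "malliavin G x \<omega> = G (add_dirac \<omega> x) - G \<omega>"


section \<open>The Poisson transport map\<close>

text \<open>The intensity of the process: Lebesgue measure on \<open>[0,T] \<times> [0,M]\<close> with its Borel sets.\<close>

definition lebesgue_rectangle :: "real \<Rightarrow> real \<Rightarrow> (real \<times> real) measure" where
  "lebesgue_rectangle T M = restrict_space lborel ({0..T} \<times> {0..M})"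

text \<open>\<open>(X, \<Lambda>)\<close> solves the defining system at every \<open>\<omega>\<close> with finitely many atoms; these are almost
  all \<open>\<omega>\<close>, and no requirement is made at the others, where \<open>X\<close> could not be finite-valued in
  general. The region below \<open>\<Lambda>\<close> is asked to be measurable because its \<open>\<omega>\<close>-mass is meaningful only
  then (\<^const>\<open>emeasure\<close> returns 0 on non-measurable sets).\<close>

definition poisson_transport ::
  "real \<Rightarrow> real \<Rightarrow> (nat \<Rightarrow> real) \<Rightarrow> (real \<Rightarrow> (real \<times> real) measure \<Rightarrow> nat)
     \<Rightarrow> (real \<Rightarrow> (real \<times> real) measure \<Rightarrow> real) \<Rightarrow> bool" where
  "poisson_transport T M f X \<Lambda> \<longleftrightarrow>
     (\<forall>\<omega>\<in>configurations (lebesgue_rectangle T M). emeasure \<omega> (space \<omega>) < \<infinity> \<longrightarrow>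
        (\<forall>t\<in>{0..T}.
           let A = {(s, x). (s, x) \<in> {0..T} \<times> {0..M} \<and> s < t \<and> x \<le> \<Lambda> s \<omega>} in
           A \<in> sets (lebesgue_rectangle T M) \<and>
           of_nat (X t \<omega>) = emeasure \<omega> A \<and>
           \<Lambda> t \<omega> = poisson_semigroup (T - t) f (X t \<omega> + 1) / poisson_semigroup (T - t) f (X t \<omega>)))"

end

theory Submission
  imports Defs
begin

text \<open>The Poisson semigroup preserves log-concavity, so the intensity at a fixed time is a
  nonincreasing function of the current count. Compare the counts \<open>X\<close> and \<open>X'\<close> without and with
  an additional atom at \<open>(t, z)\<close>. They agree up to time \<open>t\<close>, where \<open>X' - X\<close> becomes 0 or 1. If it
  is 0, the counts agree forever. As long as it is 1, the intensity of \<open>X'\<close> is at most that of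
  \<open>X\<close>, so \<open>X'\<close> can only jump together with \<open>X\<close>; as almost surely no two atoms occur at the same
  time, every jump of \<open>X\<close> has size 1, and the difference can only stay 1 or drop to 0.\<close>

section \<open>Log-concavity along the Poisson semigroup\<close>

text \<open>Log-concavity divided by \<open>f k * f (Suc k)\<close> is exactly the decrease of
  consecutive ratios. It is applied below to \<open>f\<close> and later to its semigroup
  image.\<close>

lemma log_concave_ratio_antimono:
  assumes "\<And>k. f k > 0" and "log_concave f" and "m \<le> n"
  shows "f (Suc n) / f n \<le> f (Suc m) / f m"
proof -
  have "f (Suc (Suc k)) / f (Suc k) \<le> f (Suc k) / f k" for k
  proof -
    have "f k * f (Suc (Suc k)) \<le> (f (Suc k))\<^sup>2"
      using assms(2)[unfolded log_concave_def, rule_format, of "Suc k"] by simp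
    then show ?thesis
      using assms(1)[of k] assms(1)[of "Suc k"]
      by (simp add: field_simps power2_eq_square)
  qed
  then show ?thesis
    using lift_Suc_antimono_le[of "\<lambda>k. f (Suc k) / f k"] \<open>m \<le> n\<close> by blast
qed

text \<open>Every ratio is at most the first one, so growth is at most geometric. This makes the
  series defining the semigroup converge by comparison with an exponential series.\<close>

lemma log_concave_geometric_bound:
  assumes "\<And>k. f k > 0" and "log_concave f"
  shows "f (k + n) \<le> f k * (f 1 / f 0) ^ n"
proof (induction n)
  case (Suc n)
  have "f (Suc (k + n)) = f (k + n) * (f (Suc (k + n)) / f (k + n))"
    using assms(1)[of "k + n"] by simp
  also have "\<dots> \<le> (f k * (f 1 / f 0) ^ n) * (f 1 / f 0)"
    using log_concave_ratio_antimono[OF assms, of 0 "k + n"] Suc assms(1)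
    by (intro mult_mono) (auto simp: less_imp_le intro!: mult_nonneg_nonneg)
  finally show ?case by (simp add: mult_ac)
qed simp

lemma summable_log_concave_exp:
  fixes s :: real
  assumes "\<And>k. f k > 0" and "log_concave f" and "s \<ge> 0"
  shows "summable (\<lambda>n. f (k + n) * (s ^ n / fact n))"
proof (rule summable_comparison_test)
  show "summable (\<lambda>n. f k * ((f 1 / f 0 * s) ^ n /\<^sub>R fact n))"
    by (intro summable_mult summable_exp_generic)
  have "norm (f (k + n) * (s ^ n / fact n)) \<le> f k * ((f 1 / f 0 * s) ^ n /\<^sub>R fact n)" for n
  proof -
    have "f (k + n) * (s ^ n / fact n) \<le> (f k * (f 1 / f 0) ^ n) * (s ^ n / fact n)"
      using assms log_concave_geometric_bound[OF assms(1,2)] by (intro mult_right_mono) auto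
    then show ?thesis
      using assms(1)[of "k + n"] assms(3)
      by (simp add: power_mult_distrib power_divide divide_simps mult_ac abs_mult)
  qed
  then show "\<exists>N. \<forall>n\<ge>N. norm (f (k + n) * (s ^ n / fact n)) \<le> f k * ((f 1 / f 0 * s) ^ n /\<^sub>R fact n)"
    by blast
qed

lemma poisson_semigroup_eq:
  assumes "\<And>k. f k > 0" and "log_concave f" and "s > 0"
  shows "poisson_semigroup s f k = exp (- s) * (\<Sum>n. f (k + n) * (s ^ n / fact n))"
proof -
  have "poisson_semigroup s f k = (\<Sum>n. exp (- s) * (f (k + n) * (s ^ n / fact n)))"
    using \<open>s > 0\<close> by (auto simp: poisson_semigroup_def poisson_law_def mult_ac intro!: suminf_cong)
  also have "\<dots> = exp (- s) * (\<Sum>n. f (k + n) * (s ^ n / fact n))"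
    using assms by (intro suminf_mult summable_log_concave_exp) auto
  finally show ?thesis .
qed

text \<open>Under the weights \<open>w n\<close> the index \<open>n\<close> and the ratio \<open>f (k + n + 1) / f (k + n)\<close> are
  monotone in opposite directions, hence negatively correlated (Chebyshev), and
  \<open>n * w n\<close> is \<open>s\<close> times the weight for \<open>k + 1\<close> at \<open>n - 1\<close>. The comparison point \<open>m\<close>
  splits the indices into those below and above the mean \<open>c\<close>.\<close>

lemma log_concave_exp_sum:
  fixes s :: real
  assumes pos: "\<And>k. f k > 0" and lc: "log_concave f" and s: "s > 0"
  defines "S \<equiv> \<lambda>k. \<Sum>n. f (k + n) * (s ^ n / fact n)"
  shows "S k * S (Suc (Suc k)) \<le> (S (Suc k))\<^sup>2"
proof -
  define a where "a k n = f (k + n) * (s ^ n / fact n)" for k n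
  have sums: "a k sums S k" for k
    using summable_log_concave_exp[OF pos lc, of s k] s
    unfolding S_def a_def by (intro summable_sums) auto
  have a_pos: "a k n > 0" for k n
    using pos s by (simp add: a_def)
  have S_pos: "S k > 0" for k
    using suminf_pos[OF sums_summable[OF sums[of k]] a_pos] sums_unique[OF sums[of k]] by simp
  define w where "w = a k"
  \<comment> \<open>The weights \<open>w\<close> have total mass \<open>S k\<close> and first moment
    \<open>s * S (Suc k)\<close> (\<open>index_weight\<close>), so \<open>c\<close> is their mean
    index.\<close>
  define c where "c = s * S (Suc k) / S k"
  define r where "r n = f (Suc (k + n)) / f (k + n)" for n
  define m where "m = nat \<lfloor>c\<rfloor>"
  have c_nonneg: "c \<ge> 0"
    using S_pos[of k] S_pos[of "Suc k"] s by (simp add: c_def)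
  have index_weight: "(\<lambda>n. real n * a k n) sums (s * S (Suc k))" for k
  proof -
    have "real (Suc n) * a k (Suc n) = s * a (Suc k) n" for n
      by (simp add: a_def field_simps del: of_nat_Suc)
    then have "(\<lambda>n. real (Suc n) * a k (Suc n)) sums (s * S (Suc k))"
      using sums_mult[OF sums[of "Suc k"], of s] by simp
    \<comment> \<open>The term at index 0 vanishes, so undoing the shift by one does not change the
      sum.\<close>
    then show ?thesis
      by (subst (asm) sums_Suc_iff) simp
  qed
  have wr: "w n * r n = a (Suc k) n" for n
    using pos[of "k + n"] by (simp add: w_def a_def r_def)
  \<comment> \<open>The summand is \<open>w n * (n - c) * (r n - r m)\<close>. Subtracting the
    constant \<open>r m\<close> costs nothing, since \<open>n - c\<close> has weighted sum zero; it
    makes every summand nonpositive.\<close>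
  have "(\<lambda>n. real n * a (Suc k) n - c * a (Suc k) n - r m * (real n * w n - c * w n)) sums
      (s * S (Suc (Suc k)) - c * S (Suc k) - r m * (s * S (Suc k) - c * S k))"
    unfolding w_def by (intro sums_diff sums_mult index_weight sums)
  also have "s * S (Suc k) - c * S k = 0"
    using S_pos[of k] by (simp add: c_def)
  finally have 1: "(\<lambda>n. real n * a (Suc k) n - c * a (Suc k) n - r m * (real n * w n - c * w n))
      sums (s * S (Suc (Suc k)) - c * S (Suc k))"
    by simp
  have 2: "real n * a (Suc k) n - c * a (Suc k) n - r m * (real n * w n - c * w n) \<le> 0" for n
  proof -
    have "(real n - c) * (r n - r m) \<le> 0"
    proof (cases "n \<le> m")
      case True
      then have "real n \<le> c"
        using c_nonneg by (simp add: m_def le_nat_iff le_floor_iff)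
      moreover have "r m \<le> r n"
        using log_concave_ratio_antimono[OF pos lc, of "k + n" "k + m"] True by (simp add: r_def)
      ultimately show ?thesis by (simp add: mult_nonpos_nonneg)
    next
      case False
      then have "real n \<ge> c"
        using c_nonneg unfolding m_def by linarith
      moreover have "r n \<le> r m"
        using log_concave_ratio_antimono[OF pos lc, of "k + m" "k + n"] False by (simp add: r_def)
      ultimately show ?thesis by (simp add: mult_nonneg_nonpos)
    qed
    then have "w n * ((real n - c) * (r n - r m)) \<le> 0"
      using a_pos[of k n] by (simp add: w_def mult_nonneg_nonpos)
    then show ?thesis
      by (simp add: wr[symmetric] algebra_simps)
  qed
  have "s * S (Suc (Suc k)) - c * S (Suc k) \<le> 0"
    using sums_le[OF _ 1 sums_zero] 2 by simp
  then have "s * S (Suc (Suc k)) \<le> s * (S (Suc k) * S (Suc k) / S k)"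
    by (simp add: c_def mult_ac)
  then show ?thesis
    using s S_pos[of k] by (simp add: field_simps power2_eq_square)
qed

lemma poisson_semigroup_pos:
  assumes "\<And>k. f k > 0" and "log_concave f" and "s \<ge> 0"
  shows "poisson_semigroup s f k > 0"
proof (cases "s = 0")
  case False
  then have "s > 0" using assms(3) by simp
  have "(\<Sum>n. f (k + n) * (s ^ n / fact n)) > 0"
    using assms \<open>s > 0\<close> by (intro suminf_pos summable_log_concave_exp) auto
  then show ?thesis
    unfolding poisson_semigroup_eq[OF assms(1,2) \<open>s > 0\<close>] by simp
qed (simp add: poisson_semigroup_def assms)

lemma log_concave_poisson_semigroup:
  assumes "\<And>k. f k > 0" and "log_concave f" and "s \<ge> 0"
  shows "log_concave (poisson_semigroup s f)"
proof (cases "s = 0")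
  case False
  have "(poisson_semigroup s f k)\<^sup>2 \<ge> poisson_semigroup s f (k - 1) * poisson_semigroup s f (k + 1)"
    if "k \<ge> 1" for k
  proof -
    obtain j where k: "k = Suc j" using \<open>k \<ge> 1\<close> by (cases k) auto
    have "exp (- s) * exp (- s) * ((\<Sum>n. f (j + n) * (s ^ n / fact n)) * (\<Sum>n. f (Suc (Suc j) + n) * (s ^ n / fact n)))
       \<le> exp (- s) * exp (- s) * (\<Sum>n. f (Suc j + n) * (s ^ n / fact n))\<^sup>2"
      using False assms by (intro mult_left_mono log_concave_exp_sum) auto
    then show ?thesis
      using False assms
      by (simp add: k poisson_semigroup_eq[OF assms(1,2)] power_mult_distrib power2_eq_square mult_ac)
  qed
  then show ?thesis by (simp add: log_concave_def)
next
  case True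
  then have "poisson_semigroup s f = f"
    by (simp add: poisson_semigroup_def fun_eq_iff)
  then show ?thesis using assms by simp
qed


section \<open>Configurations with finitely many atoms\<close>

lemma emeasure_distr_count_space:
  assumes "finite I" and "p \<in> I \<rightarrow> space N" and "B \<in> sets N"
  shows "emeasure (distr (count_space I) N p) B = of_nat (card {i \<in> I. p i \<in> B})"
proof -
  have "emeasure (distr (count_space I) N p) B = emeasure (count_space I) (p -` B \<inter> I)"
    using assms by (subst emeasure_distr) auto
  also have "p -` B \<inter> I = {i \<in> I. p i \<in> B}" by auto
  finally show ?thesis using assms by (simp add: emeasure_count_space)
qed

text \<open>The total mass is the counting measure of the index set, which is infinite for an
  infinite set.\<close>

lemma configurations_finiteE:
  assumes "\<omega> \<in> configurations N" and "emeasure \<omega> (space N) < \<infinity>"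
  obtains I :: "nat set" and p
  where "finite I" and "p \<in> I \<rightarrow> space N" and "\<omega> = distr (count_space I) N p"
proof -
  obtain I :: "nat set" and p where *: "p \<in> I \<rightarrow> space N" "\<omega> = distr (count_space I) N p"
    using assms(1) by (auto simp: configurations_def)
  then have "emeasure \<omega> (space N) = emeasure (count_space I) (p -` space N \<inter> I)"
    by (simp add: emeasure_distr)
  also have "p -` space N \<inter> I = I" using *(1) by auto
  finally have "finite I" using assms(2) by (auto simp: emeasure_count_space split: if_splits)
  then show thesis using * that by blast
qed

text \<open>A fresh index carries the new atom, so multiplicity is counted correctly even if
  \<open>y\<close> is already an atom.\<close>

lemma add_dirac_distr_count_space:
  assumes "finite I" and "p \<in> I \<rightarrow> space N" and "y \<in> space N" and "j \<notin> I"
  shows "add_dirac (distr (count_space I) N p) y = distr (count_space (insert j I)) N (p(j := y))"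
proof (rule measure_eqI)
  fix B assume "B \<in> sets (add_dirac (distr (count_space I) N p) y)"
  then have B: "B \<in> sets N" by simp
  have "{i \<in> insert j I. (p(j := y)) i \<in> B} = {i \<in> I. p i \<in> B} \<union> (if y \<in> B then {j} else {})"
    using \<open>j \<notin> I\<close> by auto
  then have "card {i \<in> insert j I. (p(j := y)) i \<in> B}
      = card {i \<in> I. p i \<in> B} + (if y \<in> B then 1 else 0)"
    using assms by (simp add: card_Un_disjoint)
  moreover have "emeasure (distr (count_space (insert j I)) N (p(j := y))) B
      = of_nat (card {i \<in> insert j I. (p(j := y)) i \<in> B})"
    using assms B by (intro emeasure_distr_count_space) auto
  ultimately show "emeasure (add_dirac (distr (count_space I) N p) y) B
      = emeasure (distr (count_space (insert j I)) N (p(j := y))) B"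
    using assms B by (simp add: emeasure_add_dirac emeasure_distr_count_space)
qed simp


section \<open>The Poisson process has almost surely distinct atom times\<close>

lemma measurable_emeasure_configuration_algebra:
  assumes "B \<in> sets N"
  shows "(\<lambda>\<omega>. emeasure \<omega> B) \<in> borel_measurable (configuration_algebra N)"
  unfolding configuration_algebra_def using assms
  by (intro measurable_SUP1[of B]) (auto intro!: measurable_vimage_algebra1)

text \<open>The probability is \<open>1 - exp (- a) * (1 + a)\<close>, and \<open>exp (- a)\<close>
  is at least \<open>1 - a\<close>. The quadratic order in \<open>a\<close> is what beats a union
  bound over many small strips.\<close>

lemma prob_poisson_ge_2_le:
  assumes "a > 0"
  shows "measure (poisson_pmf a) {2..} \<le> a\<^sup>2"
proof -
  have "{2..} = - {0, 1::nat}" by auto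
  then have "measure (poisson_pmf a) {2..} = 1 - measure (poisson_pmf a) {0, 1}"
    using measure_pmf.prob_compl[of "{0, 1}" "poisson_pmf a"] by (simp add: Compl_eq_Diff_UNIV)
  also have "measure (poisson_pmf a) {0, 1} = exp (- a) * (1 + a)"
    using assms by (subst measure_measure_pmf_finite) (auto simp: algebra_simps)
  also have "1 - exp (- a) * (1 + a) \<le> 1 - (1 - a) * (1 + a)"
    using assms exp_ge_add_one_self[of "- a"] by (intro diff_left_mono mult_right_mono) auto
  also have "\<dots> = a\<^sup>2" by (simp add: algebra_simps power2_eq_square)
  finally show ?thesis .
qed

context
  fixes N :: "'a measure" and P
  assumes P: "poisson_process_law N P"
begin

lemma poisson_process_law_measurable:
  assumes "B \<in> sets N"
  shows "(\<lambda>\<omega>. emeasure \<omega> B) \<in> borel_measurable P"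
proof -
  have "sets P = sets (configuration_algebra N)"
    using P unfolding poisson_process_law_def by blast
  then show ?thesis
    using measurable_emeasure_configuration_algebra[OF assms] measurable_cong_sets by blast
qed

lemma poisson_process_law_emeasure:
  assumes "B \<in> sets N" and "C \<in> sets borel"
  shows "emeasure P {\<omega> \<in> space P. emeasure \<omega> B \<in> C}
    = emeasure (poisson_law (measure N B)) {n. of_nat n \<in> C}"
proof -
  have "emeasure P {\<omega> \<in> space P. emeasure \<omega> B \<in> C} = emeasure (distr P borel (\<lambda>\<omega>. emeasure \<omega> B)) C"
    using assms poisson_process_law_measurable[OF assms(1)]
    by (subst emeasure_distr) (auto intro!: arg_cong[where f="emeasure P"])
  also have "distr P borel (\<lambda>\<omega>. emeasure \<omega> B)
      = distr (measure_pmf (poisson_law (measure N B))) borel of_nat"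
    using P assms by (simp add: poisson_process_law_def)
  also have "emeasure \<dots> C = emeasure (poisson_law (measure N B)) {n. of_nat n \<in> C}"
    using assms by (subst emeasure_distr) (auto intro!: arg_cong2[where f=emeasure])
  finally show ?thesis .
qed

text \<open>The mass of the whole space has the law of a natural number, and no natural number
  embeds to infinity.\<close>

lemma poisson_process_law_AE_finite: "AE \<omega> in P. emeasure \<omega> (space N) < \<infinity>"
proof (rule AE_I')
  have "{n. of_nat n \<in> {\<infinity>::ennreal}} = {}" by auto
  then have "emeasure P {\<omega> \<in> space P. emeasure \<omega> (space N) \<in> {\<infinity>}} = 0"
    by (subst poisson_process_law_emeasure) (auto simp del: infinity_ennreal_def)
  moreover have "{\<omega> \<in> space P. emeasure \<omega> (space N) \<in> {\<infinity>}} \<in> sets P"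
    using poisson_process_law_measurable[OF sets.top] by measurable
  ultimately show "{\<omega> \<in> space P. emeasure \<omega> (space N) \<in> {\<infinity>}} \<in> null_sets P"
    by auto
qed (auto simp: less_top[symmetric])

lemma poisson_process_law_ge_2_le:
  assumes "B \<in> sets N" and "measure N B > 0"
  shows "emeasure P {\<omega> \<in> space P. emeasure \<omega> B \<ge> 2} \<le> ennreal ((measure N B)\<^sup>2)"
proof -
  have "(2::ennreal) \<le> of_nat n \<longleftrightarrow> 2 \<le> n" for n
    using of_nat_le_iff[of 2 n, where 'a=ennreal] by simp
  then have "{n. of_nat n \<in> {2::ennreal..}} = {2..}"
    by auto
  then have "emeasure P {\<omega> \<in> space P. emeasure \<omega> B \<ge> 2} = emeasure (poisson_pmf (measure N B)) {2..}"
    using poisson_process_law_emeasure[OF assms(1), of "{2..}"] assms(2)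
    by (simp add: poisson_law_def)
  then show ?thesis
    using prob_poisson_ge_2_le[OF assms(2)]
    by (simp add: measure_pmf.emeasure_eq_measure ennreal_leI)
qed

end

section \<open>Thin time strips of the rectangle\<close>

lemma sets_lebesgue_rectangle_strip:
  assumes "{a..b} \<subseteq> {0..T}"
  shows "{a..b} \<times> {0..M} \<in> sets (lebesgue_rectangle T M)"
proof -
  have "closed ({a..b} \<times> {0..M})" by (intro closed_Times) auto
  then have "{a..b} \<times> {0..M} \<in> sets borel" by auto
  moreover have "closed ({0..T} \<times> {0..M})" by (intro closed_Times) auto
  ultimately show ?thesis
    using assms unfolding lebesgue_rectangle_def
    by (subst sets_restrict_space_iff) auto
qed

lemma measure_lebesgue_rectangle_strip:
  assumes "{a..b} \<subseteq> {0..T}" and "a \<le> b" and "M \<ge> 0"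
  shows "measure (lebesgue_rectangle T M) ({a..b} \<times> {0..M}) = (b - a) * M"
proof -
  have "closed ({0..T} \<times> {0..M})" by (intro closed_Times) auto
  then have "measure (lebesgue_rectangle T M) ({a..b} \<times> {0..M}) = measure lborel ({a..b} \<times> {0..M})"
    using assms unfolding lebesgue_rectangle_def by (intro measure_restrict_space) auto
  also have "\<dots> = measure lborel (cbox (a, 0) (b, M))" by (simp add: cbox_Pair_eq)
  also have "\<dots> = (b - a) * M"
    using assms by (subst measure_lborel_cbox_eq) (auto simp: Basis_prod_def prod.union_disjoint)
  finally show ?thesis .
qed

text \<open>Two atoms at a common time fall, for every \<open>n\<close>, into one of \<open>n\<close> strips of width
  \<open>T / n\<close>; the probability of this is at most \<open>n (M T / n)\<^sup>2\<close>.\<close>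

lemma poisson_process_law_AE_strip:
  assumes "T > 0" and "M > 0" and P: "poisson_process_law (lebesgue_rectangle T M) P"
  shows "AE \<omega> in P. \<forall>t\<in>{0..T}. \<exists>a b. {a..b} \<subseteq> {0..T} \<and> t \<in> {a..b} \<and>
    \<not> emeasure \<omega> ({a..b} \<times> {0..M}) \<ge> 2"
proof -
  \<comment> \<open>For \<open>j \<le> n\<close> these are \<open>Suc n\<close> closed intervals of
    width \<open>T / Suc n\<close> covering [0,T]. The successor avoids division by zero; shared
    endpoints do no harm in a union bound.\<close>
  define B where "B n j = {real j * (T / Suc n) .. Suc j * (T / Suc n)}" for n j :: nat
  define E where "E n j = {\<omega> \<in> space P. emeasure \<omega> (B n j \<times> {0..M}) \<ge> 2}" for n j
  define F where "F n = (\<Union>j\<le>n. E n j)" for n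
  have B_sub: "B n j \<subseteq> {0..T}" if "j \<le> n" for n j
  proof -
    have "real (Suc j) * (T / Suc n) \<le> real (Suc n) * (T / Suc n)"
      using that \<open>T > 0\<close> by (intro mult_right_mono) auto
    moreover have "0 \<le> real j * (T / Suc n)" using \<open>T > 0\<close> by simp
    ultimately show ?thesis unfolding B_def by (auto simp del: of_nat_Suc)
  qed
  have B_sets: "B n j \<times> {0..M} \<in> sets (lebesgue_rectangle T M)" if "j \<le> n" for n j
    using B_sub[OF that] unfolding B_def by (rule sets_lebesgue_rectangle_strip)
  have B_measure: "measure (lebesgue_rectangle T M) (B n j \<times> {0..M}) = M * T / Suc n" if "j \<le> n" for n j
  proof -
    have "measure (lebesgue_rectangle T M) (B n j \<times> {0..M})
        = (real (Suc j) * (T / Suc n) - real j * (T / Suc n)) * M"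
      using B_sub[OF that] assms unfolding B_def
      by (intro measure_lebesgue_rectangle_strip mult_right_mono) auto
    also have "\<dots> = M * T / Suc n" by (simp add: algebra_simps add_divide_distrib)
    finally show ?thesis .
  qed
  have E_sets: "E n j \<in> sets P" if "j \<le> n" for n j
    using poisson_process_law_measurable[OF P B_sets[OF that]] unfolding E_def by measurable
  then have F_sets: "F n \<in> sets P" for n unfolding F_def by auto
  have F_le: "emeasure P (F n) \<le> ennreal ((M * T)\<^sup>2 / Suc n)" for n
  proof -
    have "emeasure P (F n) \<le> (\<Sum>j\<le>n. emeasure P (E n j))"
      unfolding F_def using E_sets by (intro emeasure_subadditive_finite) auto
    also have "\<dots> \<le> (\<Sum>j\<le>n. ennreal ((M * T / Suc n)\<^sup>2))"
      using poisson_process_law_ge_2_le[OF P B_sets] B_measure assms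
      unfolding E_def by (intro sum_mono) (simp del: of_nat_Suc)
    also have "\<dots> = ennreal (real (Suc n) * (M * T / Suc n)\<^sup>2)"
      by (subst ennreal_mult) (simp_all del: of_nat_Suc add: ennreal_of_nat_eq_real_of_nat)
    also have "real (Suc n) * (M * T / Suc n)\<^sup>2 = (M * T)\<^sup>2 / Suc n"
      by (simp add: power2_eq_square del: of_nat_Suc)
    finally show ?thesis .
  qed
  \<comment> \<open>The intersection lies in every \<open>F n\<close>, whose probability is bounded
    by a sequence tending to 0.\<close>
  have "emeasure P (\<Inter>n. F n) \<le> 0"
  proof (rule LIMSEQ_le_const)
    have "(\<lambda>n. (M * T)\<^sup>2 / Suc n) \<longlonglongrightarrow> 0"
      using tendsto_mult_right_zero[OF LIMSEQ_inverse_real_of_nat] by (simp add: divide_inverse)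
    then show "(\<lambda>n. ennreal ((M * T)\<^sup>2 / Suc n)) \<longlonglongrightarrow> 0"
      using tendsto_ennrealI by fastforce
    have "emeasure P (\<Inter>n. F n) \<le> emeasure P (F n)" for n
      using F_sets by (intro emeasure_mono) auto
    then show "\<exists>N. \<forall>n\<ge>N. emeasure P (\<Inter>n. F n) \<le> ennreal ((M * T)\<^sup>2 / Suc n)"
      using F_le order_trans by blast
  qed
  then have "(\<Inter>n. F n) \<in> null_sets P"
    using F_sets by (intro null_setsI) auto
  then show ?thesis
  proof (rule AE_I', intro subsetI INT_I)
    fix \<omega> n
    assume "\<omega> \<in> {\<omega> \<in> space P. \<not> (\<forall>t\<in>{0..T}. \<exists>a b. {a..b} \<subseteq> {0..T} \<and> t \<in> {a..b} \<and>
      \<not> emeasure \<omega> ({a..b} \<times> {0..M}) \<ge> 2)}"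
    then obtain t where \<omega>: "\<omega> \<in> space P" and t: "t \<in> {0..T}"
      and *: "\<nexists>a b. {a..b} \<subseteq> {0..T} \<and> t \<in> {a..b} \<and> \<not> emeasure \<omega> ({a..b} \<times> {0..M}) \<ge> 2"
      by blast
    \<comment> \<open>The floor selects the strip containing \<open>t\<close>. The minimum matters
      only at \<open>t = T\<close>, where the floor is \<open>Suc n\<close> and \<open>t\<close> is
      the right endpoint of the last strip.\<close>
    define j where "j = min n (nat \<lfloor>t * Suc n / T\<rfloor>)"
    have j: "j \<le> n" by (simp add: j_def)
    have "t \<in> B n j"
    proof -
      have le: "t * Suc n / T \<le> Suc n" and nonneg: "t * Suc n / T \<ge> 0"
        using t \<open>T > 0\<close> by (simp_all add: field_simps del: of_nat_Suc)
      then have "real j \<le> t * Suc n / T" "t * Suc n / T \<le> Suc j"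
        unfolding j_def by linarith+
      then show ?thesis
        using \<open>T > 0\<close> by (simp add: B_def field_simps del: of_nat_Suc)
    qed
    then have "emeasure \<omega> (B n j \<times> {0..M}) \<ge> 2"
      using * B_sub[OF j] unfolding B_def by blast
    then show "\<omega> \<in> F n"
      using \<omega> j unfolding F_def E_def by auto
  qed
qed

text \<open>Two indices with a common time would both count in any strip around it, giving mass at
  least 2. Injectivity on indices also excludes repeated atoms.\<close>

lemma inj_on_atom_times:
  assumes I: "finite I" "p \<in> I \<rightarrow> space (lebesgue_rectangle T M)"
    and strip: "\<forall>t\<in>{0..T}. \<exists>a b. {a..b} \<subseteq> {0..T} \<and> t \<in> {a..b} \<and>
      \<not> emeasure (distr (count_space I) (lebesgue_rectangle T M) p) ({a..b} \<times> {0..M}) \<ge> 2"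
  shows "inj_on (fst \<circ> p) I"
proof (rule inj_onI, rule ccontr)
  fix i j assume ij: "i \<in> I" "j \<in> I" "(fst \<circ> p) i = (fst \<circ> p) j" "i \<noteq> j"
  have p: "p l \<in> {0..T} \<times> {0..M}" if "l \<in> I" for l
    using I(2) that by (auto simp: lebesgue_rectangle_def space_restrict_space)
  then have "fst (p i) \<in> {0..T}" using ij(1) by (auto simp: mem_Times_iff)
  then obtain a b where ab: "{a..b} \<subseteq> {0..T}" "fst (p i) \<in> {a..b}"
      "\<not> emeasure (distr (count_space I) (lebesgue_rectangle T M) p) ({a..b} \<times> {0..M}) \<ge> 2"
    using strip by blast
  have "{i, j} \<subseteq> {l \<in> I. p l \<in> {a..b} \<times> {0..M}}"
    using ij ab(2) p[OF ij(1)] p[OF ij(2)] by (auto simp: mem_Times_iff)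
  then have "card {i, j} \<le> card {l \<in> I. p l \<in> {a..b} \<times> {0..M}}"
    using I(1) by (intro card_mono) auto
  then have "2 \<le> card {l \<in> I. p l \<in> {a..b} \<times> {0..M}}" using ij(4) by simp
  then have "(2::ennreal) \<le> of_nat (card {l \<in> I. p l \<in> {a..b} \<times> {0..M}})"
    by (metis of_nat_le_iff of_nat_numeral)
  then show False
    using ab(3) emeasure_distr_count_space[OF I sets_lebesgue_rectangle_strip[OF ab(1)]] by simp
qed


section \<open>Coupling of the process with and without an additional atom\<close>

text \<open>A statement about finite sums only: \<open>R s k\<close> is the intensity at time
  \<open>s\<close> with count \<open>k\<close>. The induction is on the number of event times before
  \<open>t\<close>. The clause for \<open>t \<le> t0\<close> ensures that the counts still agree
  when the extra atom arrives; \<open>t0\<close> may coincide with some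
  \<open>\<tau> i\<close>.\<close>

lemma thinned_count_coupling:
  fixes \<tau> :: "'i \<Rightarrow> real" and x :: "'i \<Rightarrow> real" and R :: "real \<Rightarrow> nat \<Rightarrow> real"
    and X X' :: "real \<Rightarrow> nat"
  assumes I: "finite I" "\<tau> ` I \<subseteq> {0..T}" "inj_on \<tau> I" and t0: "t0 \<in> {0..T}"
    and R: "\<And>s k. s \<in> {0..T} \<Longrightarrow> R s (Suc k) \<le> R s k"
    and X: "\<And>t. t \<in> {0..T} \<Longrightarrow> X t = card {i \<in> I. \<tau> i < t \<and> x i \<le> R (\<tau> i) (X (\<tau> i))}"
    and X': "\<And>t. t \<in> {0..T} \<Longrightarrow> X' t = card {i \<in> I. \<tau> i < t \<and> x i \<le> R (\<tau> i) (X' (\<tau> i))}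
      + (if t0 < t \<and> z0 \<le> R t0 (X' t0) then 1 else 0)"
    and t: "t \<in> {0..T}"
  shows "X' t \<in> {X t, Suc (X t)} \<and> (t \<le> t0 \<longrightarrow> X' t = X t)"
  using t
proof (induction "card {s \<in> insert t0 (\<tau> ` I). s < t}" arbitrary: t rule: less_induct)
  case less
  let ?K = "{s \<in> insert t0 (\<tau> ` I). s < t}"
  have fin: "finite ?K" using I by auto
  show ?case
  proof (cases "?K = {}")
    case True
    then have "{i \<in> I. \<tau> i < t \<and> Q i} = {}" for Q by auto
    moreover have "\<not> t0 < t" using True by auto
    ultimately show ?thesis using X[OF less.prems] X'[OF less.prems] by (simp only:) simp
  next
    case False
    \<comment> \<open>The last event before \<open>t\<close>: the counts at \<open>t\<close> are
      those at \<open>s\<close> plus the jumps at \<open>s\<close>, because the strict inequality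
      excludes atoms at \<open>s\<close> from the count at \<open>s\<close>.\<close>
    define s where "s = Max ?K"
    have s: "s \<in> insert t0 (\<tau> ` I)" "s < t"
      using Max_in[OF fin False] by (auto simp: s_def)
    have s_max: "u \<le> s" if "u \<in> insert t0 (\<tau> ` I)" "u < t" for u
      using that fin unfolding s_def by (intro Max_ge) auto
    have sT: "s \<in> {0..T}" using s(1) I(2) t0 by auto
    have "{u \<in> insert t0 (\<tau> ` I). u < s} \<subset> ?K"
    proof
      show "{u \<in> insert t0 (\<tau> ` I). u < s} \<subseteq> ?K"
        using s(2) by (intro Collect_mono) auto
      have "s \<in> ?K" using s by blast
      then show "{u \<in> insert t0 (\<tau> ` I). u < s} \<noteq> ?K" by blast
    qed
    then have IH: "X' s \<in> {X s, Suc (X s)}" "s \<le> t0 \<Longrightarrow> X' s = X s"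
      using less.hyps[OF psubset_card_mono[OF fin] sT] by auto
    define J where "J = {i \<in> I. \<tau> i = s}"
    have J_card: "card J \<le> 1"
    proof -
      have "\<exists>i. J \<subseteq> {i}"
        using I(3) unfolding J_def inj_on_def by blast
      then obtain i where "J \<subseteq> {i}" ..
      then show ?thesis using card_mono[of "{i}" J] by simp
    qed
    have finJ: "finite J" using I by (simp add: J_def)
    \<comment> \<open>Stated for an arbitrary count \<open>Y\<close> to serve both
      processes.\<close>
    have split: "card {i \<in> I. \<tau> i < t \<and> x i \<le> R (\<tau> i) (Y (\<tau> i))}
        = card {i \<in> I. \<tau> i < s \<and> x i \<le> R (\<tau> i) (Y (\<tau> i))} + card {i \<in> J. x i \<le> R s (Y s)}" for Y
    proof -
      have "{i \<in> I. \<tau> i < t \<and> x i \<le> R (\<tau> i) (Y (\<tau> i))}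
        = {i \<in> I. \<tau> i < s \<and> x i \<le> R (\<tau> i) (Y (\<tau> i))} \<union> {i \<in> J. x i \<le> R s (Y s)}"
        (is "?L = ?A \<union> ?B")
      proof (rule set_eqI)
        fix i
        show "i \<in> ?L \<longleftrightarrow> i \<in> ?A \<union> ?B"
        proof (cases "i \<in> I")
          case True
          then have "\<tau> i < t \<longleftrightarrow> \<tau> i < s \<or> \<tau> i = s"
            using s(2) s_max[of "\<tau> i"] by fastforce
          then show ?thesis using True by (auto simp: J_def)
        qed (simp add: J_def)
      qed
      then show ?thesis
        using I(1) finJ by (simp add: card_Un_disjoint J_def disjoint_iff)
    qed
    have step: "X t = X s + card {i \<in> J. x i \<le> R s (X s)}"
      using X[OF less.prems] X[OF sT] split by simp
    have step': "X' t = X' s + card {i \<in> J. x i \<le> R s (X' s)}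
        + (if s = t0 \<and> z0 \<le> R s (X' s) then 1 else 0)"
    proof -
      have "t0 < t \<longleftrightarrow> t0 < s \<or> s = t0" using s s_max[of t0] by auto
      then show ?thesis
        using X'[OF less.prems] X'[OF sT] split by auto
    qed
    have le_t0: "s < t0" if "t \<le> t0" using that s by simp
    have J1: "card {i \<in> J. x i \<le> R s (X s)} \<le> 1"
      using J_card card_mono[OF finJ, of "{i \<in> J. x i \<le> R s (X s)}"] by force
    show ?thesis
    \<comment> \<open>With equal counts both processes accept the same atoms of \<open>J\<close>, so
      only the extra atom can separate them, by one.\<close>
    proof (cases "X' s = X s")
      case True
      then show ?thesis using step step' le_t0 by auto
    next
      case False
      then have X's: "X' s = Suc (X s)" using IH(1) by auto
      \<comment> \<open>The extra atom lies in the past, so the new difference is 1 plus the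
        accepted number for \<open>X'\<close> minus that for \<open>X\<close>. The former is at most
        the latter, which is at most 1.\<close>
      have "t0 < s" using False IH(2) by linarith
      have "card {i \<in> J. x i \<le> R s (X' s)} \<le> card {i \<in> J. x i \<le> R s (X s)}"
        using finJ R[OF sT, of "X s"] X's by (intro card_mono) auto
      then show ?thesis
        using step step' X's \<open>t0 < s\<close> le_t0 J1 by auto
    qed
  qed
qed

section \<open>The transport system on finite configurations\<close>

lemma poisson_transport_count:
  assumes tr: "poisson_transport T M f X \<Lambda>"
    and I: "finite (I :: nat set)" "p \<in> I \<rightarrow> space (lebesgue_rectangle T M)"
    and \<omega>: "\<omega> = distr (count_space I) (lebesgue_rectangle T M) p"
    and t: "t \<in> {0..T}"
  shows "X t \<omega> = card {i \<in> I. fst (p i) < t \<and> snd (p i) \<le> \<Lambda> (fst (p i)) \<omega>}"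
    and "\<Lambda> t \<omega> = poisson_semigroup (T - t) f (Suc (X t \<omega>)) / poisson_semigroup (T - t) f (X t \<omega>)"
proof -
  let ?N = "lebesgue_rectangle T M"
  let ?A = "{(s, x). (s, x) \<in> {0..T} \<times> {0..M} \<and> s < t \<and> x \<le> \<Lambda> s \<omega>}"
  have "\<omega> \<in> configurations ?N"
    using I(2) \<omega> by (auto simp: configurations_def)
  moreover have "emeasure \<omega> (space \<omega>) < \<infinity>"
    using emeasure_distr_count_space[OF I sets.top] \<omega> by (simp add: of_nat_less_top)
  \<comment> \<open>Measurability of the region is what turns its mass into a number of
    indices.\<close>
  ultimately have *: "?A \<in> sets ?N" "of_nat (X t \<omega>) = emeasure \<omega> ?A"
      "\<Lambda> t \<omega> = poisson_semigroup (T - t) f (X t \<omega> + 1) / poisson_semigroup (T - t) f (X t \<omega>)"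
    using tr t unfolding poisson_transport_def Let_def by blast+
  have "{i \<in> I. p i \<in> ?A} = {i \<in> I. fst (p i) < t \<and> snd (p i) \<le> \<Lambda> (fst (p i)) \<omega>}"
    using I(2) by (auto simp: lebesgue_rectangle_def space_restrict_space split_beta mem_Times_iff Pi_iff)
  then have "of_nat (X t \<omega>) = (of_nat (card {i \<in> I. fst (p i) < t \<and> snd (p i) \<le> \<Lambda> (fst (p i)) \<omega>}) :: ennreal)"
    using *(2) emeasure_distr_count_space[OF I *(1)] \<omega> by simp
  then show "X t \<omega> = card {i \<in> I. fst (p i) < t \<and> snd (p i) \<le> \<Lambda> (fst (p i)) \<omega>}"
    using of_nat_eq_iff by blast
  show "\<Lambda> t \<omega> = poisson_semigroup (T - t) f (Suc (X t \<omega>)) / poisson_semigroup (T - t) f (X t \<omega>)"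
    using *(3) by simp
qed

theorem theorem1p2:
  fixes T M :: real and \<mu> :: "nat pmf" and f :: "nat \<Rightarrow> real"
    and P :: "(real \<times> real) measure measure"
    and X :: "real \<Rightarrow> (real \<times> real) measure \<Rightarrow> nat"
    and \<Lambda> :: "real \<Rightarrow> (real \<times> real) measure \<Rightarrow> real"
  assumes "T > 0"
    and "ultra_log_concave \<mu>"
    and "\<And>k. f k > 0" and "log_concave f"
    and "\<And>k. pmf \<mu> k = f k * pmf (poisson_law T) k"
    and "M = f 1 / f 0"
    and "poisson_process_law (lebesgue_rectangle T M) P"
    and "poisson_transport T M f X \<Lambda>"
  shows "AE \<omega> in P. \<forall>(t, z)\<in>{0..T} \<times> {0..M}.
           malliavin (\<lambda>\<eta>. real (X T \<eta>)) (t, z) \<omega> \<in> {0, 1}"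
proof -
  let ?N = "lebesgue_rectangle T M"
  have "M > 0" using assms(3)[of 0] assms(3)[of 1] assms(6) by simp
  have space_N: "space ?N = {0..T} \<times> {0..M}"
    by (simp add: lebesgue_rectangle_def space_restrict_space)
  have space_P: "space P = configurations ?N"
    using assms(7) by (simp add: poisson_process_law_def)
  define R where "R t k = poisson_semigroup (T - t) f (Suc k) / poisson_semigroup (T - t) f k" for t k
  have R: "R t (Suc k) \<le> R t k" if "t \<in> {0..T}" for t k
    unfolding R_def using that assms(3,4)
    by (intro log_concave_ratio_antimono poisson_semigroup_pos log_concave_poisson_semigroup) auto
  show ?thesis
    \<comment> \<open>None of these almost sure properties mentions the added point, so one null set
      serves all \<open>(t0, z0)\<close> at once.\<close>
    using AE_space poisson_process_law_AE_finite[OF assms(7)]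
      poisson_process_law_AE_strip[OF \<open>T > 0\<close> \<open>M > 0\<close> assms(7)]
  proof eventually_elim
    case (elim \<omega>)
    obtain I :: "nat set" and p where I: "finite I" "p \<in> I \<rightarrow> space ?N"
      and \<omega>: "\<omega> = distr (count_space I) ?N p"
      using elim(1,2) unfolding space_P by (rule configurations_finiteE)
    have inj: "inj_on (fst \<circ> p) I"
      using I elim(3) unfolding \<omega> by (rule inj_on_atom_times)
    obtain j where j: "j \<notin> I" using ex_new_if_finite[OF infinite_UNIV_nat I(1)] by blast
    have "malliavin (\<lambda>\<eta>. real (X T \<eta>)) (t0, z0) \<omega> \<in> {0, 1}"
      if tz: "t0 \<in> {0..T}" "z0 \<in> {0..M}" for t0 z0
    proof -
      define \<omega>' where "\<omega>' = add_dirac \<omega> (t0, z0)"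
      define I' where "I' = insert j I"
      define p' where "p' = p(j := (t0, z0))"
      have \<omega>'_distr: "\<omega>' = distr (count_space I') ?N p'"
        unfolding \<omega>'_def \<omega> I'_def p'_def
        using I tz j by (intro add_dirac_distr_count_space) (auto simp: space_N)
      have I': "finite I'" "p' \<in> I' \<rightarrow> space ?N"
        using I tz unfolding I'_def p'_def space_N by (simp_all add: Pi_iff)
      have times: "(fst \<circ> p) ` I \<subseteq> {0..T}" using I(2) by (auto simp: space_N Pi_iff mem_Times_iff)
      have X: "X t \<omega> = card {i \<in> I. (fst \<circ> p) i < t \<and> (snd \<circ> p) i \<le> R ((fst \<circ> p) i) (X ((fst \<circ> p) i) \<omega>)}"
        if "t \<in> {0..T}" for t
      proof -
        have "\<Lambda> (fst (p i)) \<omega> = R (fst (p i)) (X (fst (p i)) \<omega>)" if "i \<in> I" for i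
          using poisson_transport_count(2)[OF assms(8) I \<omega>, of "fst (p i)"] times that
          by (auto simp: R_def)
        then show ?thesis
          unfolding poisson_transport_count(1)[OF assms(8) I \<omega> that] comp_def
          by (intro arg_cong[where f=card]) auto
      qed
      have X': "X t \<omega>' = card {i \<in> I. (fst \<circ> p) i < t \<and> (snd \<circ> p) i \<le> R ((fst \<circ> p) i) (X ((fst \<circ> p) i) \<omega>')}
          + (if t0 < t \<and> z0 \<le> R t0 (X t0 \<omega>') then 1 else 0)"
        if "t \<in> {0..T}" for t
      proof -
        have \<Lambda>': "\<Lambda> s \<omega>' = R s (X s \<omega>')" if "s \<in> {0..T}" for s
          using poisson_transport_count(2)[OF assms(8) I' \<omega>'_distr that] by (simp add: R_def)
        \<comment> \<open>The old indices keep their atoms, now thinned by the intensity of the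
          perturbed process; index \<open>j\<close> contributes exactly when the new atom is
          accepted.\<close>
        have "{i \<in> I'. fst (p' i) < t \<and> snd (p' i) \<le> \<Lambda> (fst (p' i)) \<omega>'}
          = {i \<in> I. (fst \<circ> p) i < t \<and> (snd \<circ> p) i \<le> R ((fst \<circ> p) i) (X ((fst \<circ> p) i) \<omega>')}
            \<union> (if t0 < t \<and> z0 \<le> R t0 (X t0 \<omega>') then {j} else {})"
          using j times tz \<Lambda>' by (auto simp: I'_def p'_def split: if_splits)
        then show ?thesis
          unfolding poisson_transport_count(1)[OF assms(8) I' \<omega>'_distr that]
          using j I(1) by (simp add: card_Un_disjoint)
      qed
      have "X T \<omega>' \<in> {X T \<omega>, Suc (X T \<omega>)}"
        using thinned_count_coupling[of I "fst \<circ> p" T t0 R "\<lambda>t. X t \<omega>" "snd \<circ> p" "\<lambda>t. X t \<omega>'" z0 T]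
          I(1) times inj tz(1) R X X' \<open>T > 0\<close> by simp
      then show ?thesis
        by (auto simp: malliavin_def \<omega>'_def)
    qed
    then show ?case by blast
  qed
qed

end
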